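(* Let $I\subset\mathbb{R}$ be an open bounded interval, $U\subset\mathbb{R}^2$ an open set, and $\Phi\in C^2(I\times U)$ a real-valued function; write $\Phi_\alpha(x)=\Phi(\alpha,x)$. Assume there is a constant $C_0\ge 1$ such that for all $\alpha\in I$ and $x=(x_1,x_2)\in U$: (1) $C_0^{-1}\le |\nabla\Phi_\alpha(x)|\le C_0$; (2) $|\partial_i\partial_j\Phi_\alpha(x)|\le C_0$ for all $i,j\in\{1,2\}$; (3) $C_0^{-1}\le\left|\det\begin{pmatrix}\partial_1\Phi_\alpha(x)&\partial_\alpha\partial_1\Phi_\alpha(x)\\ \partial_2\Phi_\alpha(x)&\partial_\alpha\partial_2\Phi_\alpha(x)\end{pmatrix}\right|\le C_0$. Let $V\subset U$ be a fixed compact set. Then there exist $\delta_0>0$ (depending on $\Phi,V,I$) and a constant $C>0$ (depending only on $\Phi,U,V,I$) such that the following holds. If $Q\subset V$ is a compact square of side length $\delta<\delta_0$ and $E\subset Q$ is a union of finitely many compact squares of side length $\delta^2$, then $$\mathrm{Fav}_\Phi(E)\le C\,\mathrm{Fav}(E).$$ In particular $C$ is independent of $Q$, $E$ and $\delta$.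
   Context: Here $\nabla$, $\partial_1,\partial_2$ are derivatives in the variable $x\in U$, and $|\cdot|$ of a subset of $\mathbb{R}$ is Lebesgue measure. The generalized Favard length of $E\subset U$ is $\mathrm{Fav}_\Phi(E)=\int_I|\Phi_\alpha(E)|\,d\alpha$. The classical Favard length is $\mathrm{Fav}(E)=\int_0^\pi|\pi_\theta(E)|\,d\theta$, where $\pi_\theta(x)=x_1\cos\theta+x_2\sin\theta$. Squares may have any orientation. *)

theory Defs
  imports "HOL-Analysis.Analysis"
begin

text \<open>Twice continuously differentiable on \<open>S\<close> (meant for open \<open>S\<close>), as Frechet derivatives.\<close>

definition C2_on :: "('a::euclidean_space \<Rightarrow> 'b::real_normed_vector) \<Rightarrow> 'a set \<Rightarrow> bool" where
  "C2_on f S \<longleftrightarrow>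
    (\<exists>(f' :: 'a \<Rightarrow> 'a \<Rightarrow>\<^sub>L 'b) (f'' :: 'a \<Rightarrow> 'a \<Rightarrow>\<^sub>L ('a \<Rightarrow>\<^sub>L 'b)).
      (\<forall>x\<in>S. (f has_derivative blinfun_apply (f' x)) (at x)) \<and>
      (\<forall>x\<in>S. (f' has_derivative blinfun_apply (f'' x)) (at x)) \<and>
      continuous_on S f'')"

definition partial_deriv :: "'n::finite \<Rightarrow> (real ^ 'n \<Rightarrow> real) \<Rightarrow> real ^ 'n \<Rightarrow> real" where
  "partial_deriv i f x = deriv (\<lambda>t. f (x + t *\<^sub>R axis i 1)) 0"

definition gradient :: "(real ^ 'n::finite \<Rightarrow> real) \<Rightarrow> real ^ 'n \<Rightarrow> real ^ 'n" where
  "gradient f x = (\<chi> i. partial_deriv i f x)"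

definition parameter_deriv ::
    "'n::finite \<Rightarrow> (real \<Rightarrow> real ^ 'n \<Rightarrow> real) \<Rightarrow> real \<Rightarrow> real ^ 'n \<Rightarrow> real" where
  "parameter_deriv i \<Phi> \<alpha> x = deriv (\<lambda>\<beta>. partial_deriv i (\<Phi> \<beta>) x) \<alpha>"

text \<open>
  Both Favard lengths take values in \<^typ>\<open>ennreal\<close>, so that no integrability side condition is
  hidden in a default value. They are meant for sets \<open>E\<close> with measurable images, such as
  compact sets.
\<close>

definition gen_favard_length ::
    "real set \<Rightarrow> (real \<Rightarrow> real ^ 2 \<Rightarrow> real) \<Rightarrow> (real ^ 2) set \<Rightarrow> ennreal" where
  "gen_favard_length I \<Phi> E = (\<integral>\<^sup>+\<alpha>\<in>I. emeasure lebesgue (\<Phi> \<alpha> ` E) \<partial>lebesgue)"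

definition angle_proj :: "real \<Rightarrow> real ^ 2 \<Rightarrow> real" where
  "angle_proj \<theta> x = x $ 1 * cos \<theta> + x $ 2 * sin \<theta>"

definition favard_length :: "(real ^ 2) set \<Rightarrow> ennreal" where
  "favard_length E = (\<integral>\<^sup>+\<theta>\<in>{0..pi}. emeasure lebesgue (angle_proj \<theta> ` E) \<partial>lebesgue)"

text \<open>A nondegenerate filled square with side length \<open>s\<close>, corner \<open>p\<close> and sides parallel to the
  orthonormal vectors \<open>u\<close>, \<open>v\<close>.\<close>

definition compact_square :: "real \<Rightarrow> (real ^ 2) set \<Rightarrow> bool" where
  "compact_square s Q \<longleftrightarrow> 0 < s \<and>
    (\<exists>p u v. norm u = 1 \<and> norm v = 1 \<and> u \<bullet> v = 0 \<and>
      Q = {p + a *\<^sub>R u + b *\<^sub>R v | a b. 0 \<le> a \<and> a \<le> s \<and> 0 \<le> b \<and> b \<le> s})"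

end

theory Submission
  imports Defs
begin

text \<open>
  Let \<open>p\<close> be a corner of \<open>Q\<close> and let \<open>\<theta>(\<alpha>)\<close> be a continuous choice of the polar angle of
  \<open>\<nabla>\<Phi>\<^sub>\<alpha>(p)\<close>. By Taylor's formula and the bound on the second derivatives, \<open>\<Phi>\<^sub>\<alpha>\<close> agrees on \<open>Q\<close> up to
  \<open>O(\<delta>\<^sup>2)\<close> with an affine function of \<open>\<pi>\<^bsub>\<theta>(\<alpha>)\<^esub>\<close> of slope at most \<open>C\<^sub>0\<close>. Since \<open>E\<close> consists of squares of
  side \<open>\<delta>\<^sup>2\<close>, an error of this size costs only a constant factor:
  \<open>|\<Phi>\<^sub>\<alpha>(E)| \<le> 20 C\<^sub>0 |\<pi>\<^bsub>\<theta>(\<alpha>)\<^esub>(E)|\<close>. The derivative of \<open>\<theta>\<close> is the determinant divided by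
  \<open>|\<nabla>\<Phi>\<^sub>\<alpha>(p)|\<^sup>2\<close>, so \<open>|\<theta>'|\<close> lies between \<open>C\<^sub>0\<^sup>-\<^sup>3\<close> and \<open>C\<^sub>0\<^sup>3\<close>; substituting \<open>\<theta>\<close> for \<open>\<alpha>\<close>
  and using that \<open>|\<pi>\<^sub>\<theta>(E)|\<close> has period \<open>\<pi>\<close> bounds the integral by a multiple of \<open>Fav(E)\<close>.
\<close>

subsection \<open>Projections of squares\<close>

text \<open>Greedy choice: points are examined one by one, and a point is kept only when it is
  farther than \<open>r\<close> from all points kept so far. The separation is strict so that closed
  balls of radius \<open>r / 2\<close> around the kept points are disjoint.\<close>

lemma finite_separated_subset:
  fixes A :: "'a::metric_space set"
  assumes "finite A" "0 \<le> r"
  shows "\<exists>T\<subseteq>A. (\<forall>x\<in>T. \<forall>y\<in>T. x \<noteq> y \<longrightarrow> r < dist x y) \<and> (\<forall>x\<in>A. \<exists>t\<in>T. dist x t \<le> r)"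
  using assms(1)
proof (induction A)
  case empty
  then show ?case by auto
next
  case (insert a A)
  then obtain T where T: "T \<subseteq> A" "\<forall>x\<in>T. \<forall>y\<in>T. x \<noteq> y \<longrightarrow> r < dist x y"
    "\<forall>x\<in>A. \<exists>t\<in>T. dist x t \<le> r" by blast
  show ?case
  proof (cases "\<exists>t\<in>T. dist a t \<le> r")
    case True
    with T show ?thesis by (intro exI[of _ T]) auto
  next
    case False
    with T have "\<forall>x\<in>insert a T. \<forall>y\<in>insert a T. x \<noteq> y \<longrightarrow> r < dist x y"
      by (auto simp: dist_commute not_le)
    moreover have "\<forall>x\<in>insert a A. \<exists>t\<in>insert a T. dist x t \<le> r"
      using T(3) \<open>0 \<le> r\<close> by auto
    ultimately show ?thesis
      using T(1) by (intro exI[of _ "insert a T"]) auto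
  qed
qed

lemma angle_proj_add: "angle_proj \<theta> (x + y) = angle_proj \<theta> x + angle_proj \<theta> y"
  by (simp add: angle_proj_def algebra_simps)

lemma angle_proj_diff: "angle_proj \<theta> (x - y) = angle_proj \<theta> x - angle_proj \<theta> y"
  by (simp add: angle_proj_def algebra_simps)

lemma angle_proj_scaleR: "angle_proj \<theta> (c *\<^sub>R x) = c * angle_proj \<theta> x"
  by (simp add: angle_proj_def algebra_simps)

lemma angle_proj_inner: "angle_proj \<theta> x = x \<bullet> vector [cos \<theta>, sin \<theta>]"
  by (simp add: angle_proj_def inner_vec_def sum_2)

lemma abs_angle_proj_le: "\<bar>angle_proj \<theta> x\<bar> \<le> norm x"
proof -
  have "norm (vector [cos \<theta>, sin \<theta>] :: real ^ 2) = 1"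
    by (simp add: norm_vec_def L2_set_def sum_2)
  then show ?thesis
    using Cauchy_Schwarz_ineq2[of x "vector [cos \<theta>, sin \<theta>]"] by (simp add: angle_proj_inner)
qed

lemma angle_proj_add_pi: "angle_proj (\<theta> + pi) x = - angle_proj \<theta> x"
  by (simp add: angle_proj_def)

text \<open>The two terms are the squared coordinates of the unit vector at angle \<theta> in the
  orthonormal basis \<open>u\<close>, \<open>v\<close>.\<close>

lemma angle_proj_Parseval:
  assumes "norm u = 1" "norm v = 1" "u \<bullet> v = 0"
  shows "(angle_proj \<theta> u)\<^sup>2 + (angle_proj \<theta> v)\<^sup>2 = 1"
proof -
  define a b c d where "a = u $ 1" and "b = u $ 2" and "c = v $ 1" and "d = v $ 2"
  define p q where "p = cos \<theta>" and "q = sin \<theta>"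
  have 1: "a\<^sup>2 + b\<^sup>2 = 1" "c\<^sup>2 + d\<^sup>2 = 1" "a * c + b * d = 0"
    using assms by (auto simp: norm_eq_1 inner_vec_def sum_2 a_def b_def c_def d_def power2_eq_square)
  have 2: "p\<^sup>2 + q\<^sup>2 = 1" by (simp add: p_def q_def)
  have "(a * p + b * q)\<^sup>2 + (c * p + d * q)\<^sup>2 = 1"
  proof -
    \<comment> \<open>The matrix with rows \<open>(a, b)\<close> and \<open>(c, d)\<close> is
      orthogonal, so its columns are orthonormal as well.\<close>
    have 3: "a\<^sup>2 + c\<^sup>2 = 1" "b\<^sup>2 + d\<^sup>2 = 1" "a * b + c * d = 0"
      using 1 by algebra+
    have "(a * p + b * q)\<^sup>2 + (c * p + d * q)\<^sup>2
        = p\<^sup>2 * (a\<^sup>2 + c\<^sup>2) + q\<^sup>2 * (b\<^sup>2 + d\<^sup>2) + 2 * p * q * (a * b + c * d)"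
      by (simp add: power2_eq_square algebra_simps)
    then show ?thesis using 2 3 by simp
  qed
  then show ?thesis by (simp add: angle_proj_def a_def b_def c_def d_def p_def q_def)
qed

lemma compact_compact_square:
  assumes "compact_square s Q"
  shows "compact Q"
proof -
  obtain p u v where Q: "Q = {p + a *\<^sub>R u + b *\<^sub>R v | a b. 0 \<le> a \<and> a \<le> s \<and> 0 \<le> b \<and> b \<le> s}"
    using assms unfolding compact_square_def by blast
  have "Q = (\<lambda>(a, b). p + a *\<^sub>R u + b *\<^sub>R v) ` ({0..s} \<times> {0..s})"
    unfolding Q image_def by (force simp: Bex_def)
  also have "compact \<dots>"
    by (intro compact_continuous_image compact_Times compact_Icc)
       (auto simp: case_prod_beta intro!: continuous_intros)
  finally show ?thesis .
qed

text \<open>The corner serves as base point of the Taylor expansion. The segments are recorded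
  because \<open>U\<close> need not be convex, so the expansion has to run inside \<open>Q\<close>.
  The factor 2 comes from the triangle inequality along two sides.\<close>

lemma compact_square_corner:
  assumes "compact_square s Q"
  obtains p where "p \<in> Q" "\<And>x. x \<in> Q \<Longrightarrow> dist x p \<le> 2 * s \<and> closed_segment p x \<subseteq> Q"
proof -
  obtain p u v where s: "0 < s" and n: "norm u = 1" "norm v = 1"
    and Q: "Q = {p + a *\<^sub>R u + b *\<^sub>R v | a b. 0 \<le> a \<and> a \<le> s \<and> 0 \<le> b \<and> b \<le> s}"
    using assms unfolding compact_square_def by blast
  show ?thesis
  proof
    show "p \<in> Q" using s unfolding Q by force
    fix x assume "x \<in> Q"
    then obtain a b where x: "x = p + a *\<^sub>R u + b *\<^sub>R v" and ab: "0 \<le> a" "a \<le> s" "0 \<le> b" "b \<le> s"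
      unfolding Q by blast
    have "dist x p = norm (a *\<^sub>R u + b *\<^sub>R v)" by (simp add: x dist_norm)
    also have "\<dots> \<le> norm (a *\<^sub>R u) + norm (b *\<^sub>R v)" by (rule norm_triangle_ineq)
    also have "\<dots> \<le> 2 * s" using n ab by simp
    finally have "dist x p \<le> 2 * s" .
    moreover have "closed_segment p x \<subseteq> Q"
    proof
      fix y assume "y \<in> closed_segment p x"
      then obtain t where t: "0 \<le> t" "t \<le> 1" "y = (1 - t) *\<^sub>R p + t *\<^sub>R x"
        by (auto simp: closed_segment_def)
      have "y = p + (t * a) *\<^sub>R u + (t * b) *\<^sub>R v"
        by (simp add: t(3) x algebra_simps)
      moreover have "t * a \<le> s" "t * b \<le> s"
        using t ab mult_mono[of t 1 a s] mult_mono[of t 1 b s] by auto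
      ultimately show "y \<in> Q"
        using t ab unfolding Q by (intro CollectI exI[of _ "t * a"] exI[of _ "t * b"]) auto
    qed
    ultimately show "dist x p \<le> 2 * s \<and> closed_segment p x \<subseteq> Q" ..
  qed
qed

text \<open>Whatever its orientation, a square of side \<open>s\<close> contains the disc of radius
  \<open>s / 2\<close> about its centre, and every projection of that disc is an interval of length
  \<open>s\<close>.\<close>

lemma compact_square_center:
  assumes "compact_square s S"
  obtains c where "c \<in> S" "S \<subseteq> cball c s"
    "\<And>\<theta>. cball (angle_proj \<theta> c) (s / 2) \<subseteq> angle_proj \<theta> ` S"
proof -
  obtain p u v where s: "0 < s" and n: "norm u = 1" "norm v = 1" and o: "u \<bullet> v = 0"
    and S: "S = {p + a *\<^sub>R u + b *\<^sub>R v | a b. 0 \<le> a \<and> a \<le> s \<and> 0 \<le> b \<and> b \<le> s}"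
    using assms unfolding compact_square_def by blast
  define c where "c = p + (s / 2) *\<^sub>R u + (s / 2) *\<^sub>R v"
  have mem: "c + a *\<^sub>R u + b *\<^sub>R v \<in> S" if "\<bar>a\<bar> \<le> s / 2" "\<bar>b\<bar> \<le> s / 2" for a b
  proof -
    have "c + a *\<^sub>R u + b *\<^sub>R v = p + (s / 2 + a) *\<^sub>R u + (s / 2 + b) *\<^sub>R v"
      by (simp add: c_def algebra_simps)
    moreover have "0 \<le> s / 2 + a" "s / 2 + a \<le> s" "0 \<le> s / 2 + b" "s / 2 + b \<le> s"
      using that by auto
    ultimately show ?thesis unfolding S by blast
  qed
  show ?thesis
  proof
    show "c \<in> S" using mem[of 0 0] s by simp
    show "S \<subseteq> cball c s"
    proof
      fix x assume "x \<in> S"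
      then obtain a b where x: "x = p + a *\<^sub>R u + b *\<^sub>R v"
        and ab: "0 \<le> a" "a \<le> s" "0 \<le> b" "b \<le> s"
        unfolding S by blast
      have "x - c = (a - s / 2) *\<^sub>R u + (b - s / 2) *\<^sub>R v"
        by (simp add: x c_def algebra_simps)
      then have "norm (x - c) \<le> norm ((a - s / 2) *\<^sub>R u) + norm ((b - s / 2) *\<^sub>R v)"
        by (metis norm_triangle_ineq)
      also have "\<dots> \<le> s" using n ab by (simp add: abs_real_def)
      finally show "x \<in> cball c s" by (simp add: dist_norm norm_minus_commute)
    qed
    fix \<theta>
    show "cball (angle_proj \<theta> c) (s / 2) \<subseteq> angle_proj \<theta> ` S"
    proof
      fix y assume "y \<in> cball (angle_proj \<theta> c) (s / 2)"
      then have y: "\<bar>y - angle_proj \<theta> c\<bar> \<le> s / 2" by (auto simp: dist_real_def abs_minus_commute)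
      define t where "t = y - angle_proj \<theta> c"
      \<comment> \<open>The point at signed distance \<open>t\<close> from the centre in direction
        \<theta>, written in the basis \<open>u\<close>, \<open>v\<close> so that membership in
        \<open>S\<close> can be read off from its coordinates.\<close>
      define x where "x = c + (t * angle_proj \<theta> u) *\<^sub>R u + (t * angle_proj \<theta> v) *\<^sub>R v"
      have "\<bar>t * angle_proj \<theta> w\<bar> \<le> s / 2" if "norm w = 1" for w
        using y mult_mono[of "\<bar>t\<bar>" "s / 2" "\<bar>angle_proj \<theta> w\<bar>" 1] abs_angle_proj_le[of \<theta> w] that s
        by (simp add: t_def abs_mult)
      then have "x \<in> S" unfolding x_def using n by (intro mem) auto
      moreover have "angle_proj \<theta> x
          = angle_proj \<theta> c + t * ((angle_proj \<theta> u)\<^sup>2 + (angle_proj \<theta> v)\<^sup>2)"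
        by (simp add: x_def angle_proj_add angle_proj_scaleR power2_eq_square algebra_simps)
      then have "y = angle_proj \<theta> x" using angle_proj_Parseval[OF n o] by (simp add: t_def)
      ultimately show "y \<in> angle_proj \<theta> ` S" by blast
    qed
  qed
qed

text \<open>
  The centres of a maximal family of squares whose centres have \<open>s\<close>-separated projections give
  disjoint intervals of length \<open>s\<close> in \<open>angle_proj \<theta> ` \<Union>\<S>\<close>, and by maximality the image of
  every square under \<open>f\<close> is close to the affine image of one of these centres.
\<close>

lemma emeasure_image_squares_le:
  fixes f :: "real ^ 2 \<Rightarrow> real"
  assumes fin: "finite \<S>" and sq: "\<And>S. S \<in> \<S> \<Longrightarrow> compact_square s S"
    and f: "\<And>x. x \<in> \<Union>\<S> \<Longrightarrow> \<bar>f x - (c + \<rho> * angle_proj \<theta> x)\<bar> \<le> K * s"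
    and \<rho>: "\<bar>\<rho>\<bar> \<le> M"
  shows "emeasure lebesgue (f ` \<Union>\<S>)
    \<le> ennreal (2 * (K + 2 * M)) * emeasure lebesgue (angle_proj \<theta> ` \<Union>\<S>)"
proof (cases "\<S> = {}")
  case False
  then obtain S0 where S0: "S0 \<in> \<S>" by blast
  have s: "0 < s" using sq[OF S0] by (simp add: compact_square_def)
  have M: "0 \<le> M" using \<rho> by linarith
  have "\<forall>S\<in>\<S>. \<exists>m. m \<in> S \<and> S \<subseteq> cball m s \<and>
      cball (angle_proj \<theta> m) (s / 2) \<subseteq> angle_proj \<theta> ` S"
    using sq compact_square_center by metis
  then obtain m where m: "\<And>S. S \<in> \<S> \<Longrightarrow> m S \<in> S" "\<And>S. S \<in> \<S> \<Longrightarrow> S \<subseteq> cball (m S) s"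
    "\<And>S. S \<in> \<S> \<Longrightarrow> cball (angle_proj \<theta> (m S)) (s / 2) \<subseteq> angle_proj \<theta> ` S"
    by metis
  have K: "0 \<le> K"
    using f[of "m S0"] m(1)[OF S0] S0 s
    by (meson UnionI abs_ge_zero order_trans zero_le_mult_iff less_le_not_le)
  let ?A = "(\<lambda>S. angle_proj \<theta> (m S)) ` \<S>"
  obtain T where T: "T \<subseteq> ?A" "\<And>x y. x \<in> T \<Longrightarrow> y \<in> T \<Longrightarrow> x \<noteq> y \<Longrightarrow> s < dist x y"
    "\<And>x. x \<in> ?A \<Longrightarrow> \<exists>t\<in>T. dist x t \<le> s"
    using finite_separated_subset[OF finite_imageI[OF fin] less_imp_le[OF s]] by metis
  have finT: "finite T" using T(1) fin finite_subset by blast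
  \<comment> \<open>\<open>K * s\<close> is the error of the affine approximation. The projection of
    a point of a square is within \<open>s\<close> of that of the centre, which is within
    \<open>s\<close> of some \<open>t\<close> in \<open>T\<close>; the slope turns this
    \<open>2 * s\<close> into at most \<open>2 * M * s\<close>.\<close>
  define L where "L = (K + 2 * M) * s"
  have L: "0 \<le> L" using K M s by (simp add: L_def)
  have "f ` \<Union>\<S> \<subseteq> (\<Union>t\<in>T. cball (c + \<rho> * t) L)"
  proof
    fix y assume "y \<in> f ` \<Union>\<S>"
    then obtain S x where x: "S \<in> \<S>" "x \<in> S" "y = f x" by blast
    obtain t where t: "t \<in> T" "dist (angle_proj \<theta> (m S)) t \<le> s" using T(3) x(1) by blast
    have "\<bar>angle_proj \<theta> x - angle_proj \<theta> (m S)\<bar> \<le> norm (x - m S)"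
      by (metis abs_angle_proj_le angle_proj_diff)
    also have "\<dots> \<le> s"
      using m(2)[OF x(1)] x(2) by (auto simp: dist_norm norm_minus_commute)
    finally have "\<bar>angle_proj \<theta> x - t\<bar> \<le> 2 * s"
      using t(2) by (simp add: dist_real_def)
    then have "\<bar>\<rho>\<bar> * \<bar>angle_proj \<theta> x - t\<bar> \<le> M * (2 * s)"
      using \<rho> M by (intro mult_mono) auto
    then have "\<bar>\<rho> * angle_proj \<theta> x - \<rho> * t\<bar> \<le> 2 * M * s"
      by (simp add: abs_mult[symmetric] algebra_simps)
    moreover have "\<bar>f x - (c + \<rho> * angle_proj \<theta> x)\<bar> \<le> K * s"
      using f x by blast
    ultimately have "y \<in> cball (c + \<rho> * t) L"
      unfolding L_def x(3) by (simp add: dist_real_def algebra_simps)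
    with t(1) show "y \<in> (\<Union>t\<in>T. cball (c + \<rho> * t) L)" by blast
  qed
  then have "emeasure lebesgue (f ` \<Union>\<S>) \<le> emeasure lebesgue (\<Union>t\<in>T. cball (c + \<rho> * t) L)"
    by (intro emeasure_mono) (auto intro!: sets.finite_UN finT)
  also have "\<dots> \<le> (\<Sum>t\<in>T. emeasure lebesgue (cball (c + \<rho> * t) L))"
    by (intro emeasure_subadditive_finite finT) auto
  also have "\<dots> = ennreal (real (card T) * (2 * L))"
    using L by (simp add: cball_eq_atLeastAtMost ennreal_mult ennreal_of_nat_eq_real_of_nat)
  \<comment> \<open>The constant is the ratio of the length \<open>2 * L\<close> of the covering
    intervals to the length \<open>s\<close> of the disjoint ones.\<close>
  also have "\<dots> = ennreal (2 * (K + 2 * M)) * ennreal (real (card T) * s)"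
    using K M s by (simp add: L_def ennreal_mult[symmetric] algebra_simps)
  also have "ennreal (real (card T) * s) = (\<Sum>t\<in>T. emeasure lebesgue (cball t (s / 2)))"
    using s by (simp add: cball_eq_atLeastAtMost ennreal_mult ennreal_of_nat_eq_real_of_nat)
  also have "\<dots> = emeasure lebesgue (\<Union>t\<in>T. cball t (s / 2))"
  proof (rule sum_emeasure)
    have "False" if "x \<in> T" "y \<in> T" "x \<noteq> y" "z \<in> cball x (s / 2)" "z \<in> cball y (s / 2)" for x y z
      using T(2)[OF that(1-3)] that(4,5) dist_triangle2[of x y z] by (simp add: dist_commute)
    then show "disjoint_family_on (\<lambda>t. cball t (s / 2)) T"
      unfolding disjoint_family_on_def by blast
  qed (use finT in auto)
  also have "\<dots> \<le> emeasure lebesgue (angle_proj \<theta> ` \<Union>\<S>)"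
  proof (rule emeasure_mono)
    show "(\<Union>t\<in>T. cball t (s / 2)) \<subseteq> angle_proj \<theta> ` \<Union>\<S>"
      using T(1) m(3) by blast
    have "compact (\<Union>\<S>)" using fin sq compact_compact_square by (intro compact_Union) auto
    then have "compact (angle_proj \<theta> ` \<Union>\<S>)"
      unfolding angle_proj_def by (intro compact_continuous_image continuous_intros)
    then show "angle_proj \<theta> ` \<Union>\<S> \<in> sets lebesgue"
      by (metis borel_compact sets_completionI_sets sets_lborel)
  qed
  finally show ?thesis by (simp add: mult_left_mono)
qed simp

subsection \<open>Integrals of projection lengths over angles\<close>

lemma borel_measurable_emeasure_angle_proj:
  assumes "compact E"
  shows "(\<lambda>\<theta>. emeasure lborel (angle_proj \<theta> ` E)) \<in> borel_measurable borel"
proof -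
  \<comment> \<open>the emeasure is that of the sections of a \<open>\<sigma>\<close>-compact subset of the plane\<close>
  define A where "A n = (\<lambda>(\<theta>, x). (\<theta>, angle_proj \<theta> x)) ` ({- real n..real n} \<times> E)" for n
  have A: "compact (A n)" for n
    unfolding A_def angle_proj_def
    by (intro compact_continuous_image compact_Times compact_Icc assms)
       (auto simp: case_prod_beta intro!: continuous_intros)
  have "(\<Union>n. A n) \<in> sets (borel \<Otimes>\<^sub>M lborel)"
  proof (intro sets.countable_UN image_subsetI)
    fix n
    have "A n \<in> sets (borel :: (real \<times> real) measure)" using A by (rule borel_compact)
    also have "\<dots> = sets ((borel :: real measure) \<Otimes>\<^sub>M (lborel :: real measure))"
      by (subst borel_prod[symmetric]) (intro sets_pair_measure_cong; simp)
    finally show "A n \<in> sets (borel \<Otimes>\<^sub>M lborel)" .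
  qed
  then have "(\<lambda>\<theta>. emeasure lborel (Pair \<theta> -` (\<Union>n. A n))) \<in> borel_measurable borel"
    by (rule lborel.measurable_emeasure_Pair)
  moreover have "Pair \<theta> -` (\<Union>n. A n) = angle_proj \<theta> ` E" for \<theta>
  proof -
    obtain n :: nat where "\<bar>\<theta>\<bar> \<le> real n" using real_arch_simple by blast
    then have "\<theta> \<in> {- real n..real n}" by auto
    then show ?thesis unfolding A_def by (force simp: image_iff)
  qed
  ultimately show ?thesis by simp
qed

lemma compact_angle_proj: "compact E \<Longrightarrow> compact (angle_proj \<theta> ` E)"
  unfolding angle_proj_def by (intro compact_continuous_image continuous_intros)

lemma emeasure_angle_proj_lborel:
  assumes "compact E"
  shows "emeasure lebesgue (angle_proj \<theta> ` E) = emeasure lborel (angle_proj \<theta> ` E)"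
  using borel_compact[OF compact_angle_proj[OF assms]] by simp

lemma favard_length_lborel:
  assumes "compact E"
  shows "favard_length E = (\<integral>\<^sup>+\<theta>\<in>{0..pi}. emeasure lborel (angle_proj \<theta> ` E) \<partial>lborel)"
  unfolding favard_length_def emeasure_angle_proj_lborel[OF assms] by (rule nn_integral_completion)

text \<open>Turning the direction by \<open>pi\<close> reflects the projection in the origin, which
  preserves Lebesgue measure.\<close>

lemma emeasure_angle_proj_add_pi:
  assumes "compact E"
  shows "emeasure lborel (angle_proj (\<theta> + pi) ` E) = emeasure lborel (angle_proj \<theta> ` E)"
proof -
  have m: "angle_proj \<theta> ` E \<in> sets borel"
    by (intro borel_compact compact_angle_proj assms)
  have "emeasure lborel (angle_proj \<theta> ` E)
      = emeasure (distr lborel borel uminus) (angle_proj \<theta> ` E)"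
    by (simp add: lborel_distr_uminus)
  also have "\<dots> = emeasure lborel (uminus -` (angle_proj \<theta> ` E))"
    using m by (subst emeasure_distr) auto
  also have "uminus -` (angle_proj \<theta> ` E) = angle_proj (\<theta> + pi) ` E"
    by (force simp: angle_proj_add_pi image_iff)
  finally show ?thesis by simp
qed

lemma nn_integral_angle_proj_period:
  assumes "compact E"
  shows "(\<integral>\<^sup>+\<theta>\<in>{a + pi..b + pi}. emeasure lborel (angle_proj \<theta> ` E) \<partial>lborel)
    = (\<integral>\<^sup>+\<theta>\<in>{a..b}. emeasure lborel (angle_proj \<theta> ` E) \<partial>lborel)"
proof -
  note [measurable] = borel_measurable_emeasure_angle_proj[OF assms]
  have "(\<integral>\<^sup>+\<theta>\<in>{a + pi..b + pi}. emeasure lborel (angle_proj \<theta> ` E) \<partial>lborel)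
      = (\<integral>\<^sup>+\<theta>. emeasure lborel (angle_proj (pi + 1 * \<theta>) ` E)
          * indicator {a + pi..b + pi} (pi + 1 * \<theta>) \<partial>lborel)"
    by (subst nn_integral_real_affine[where c = 1 and t = pi]) auto
  also have "\<dots> = (\<integral>\<^sup>+\<theta>\<in>{a..b}. emeasure lborel (angle_proj \<theta> ` E) \<partial>lborel)"
    using emeasure_angle_proj_add_pi[OF assms]
    by (intro nn_integral_cong) (auto simp: add.commute indicator_def)
  finally show ?thesis .
qed

text \<open>The induction runs in both directions because a range of angles may lie on either side
  of the origin.\<close>

lemma nn_integral_angle_proj_shift:
  fixes k :: int
  assumes "compact E"
  shows "(\<integral>\<^sup>+\<theta>\<in>{a + k * pi..b + k * pi}. emeasure lborel (angle_proj \<theta> ` E) \<partial>lborel)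
    = (\<integral>\<^sup>+\<theta>\<in>{a..b}. emeasure lborel (angle_proj \<theta> ` E) \<partial>lborel)" (is "?I k = ?I'")
proof (induction k rule: int_induct[where k = 0])
  case base
  then show ?case by simp
next
  case (step1 i)
  then show ?case
    using nn_integral_angle_proj_period[OF assms, of "a + i * pi" "b + i * pi"]
    by (simp add: algebra_simps)
next
  case (step2 i)
  then show ?case
    using nn_integral_angle_proj_period[OF assms, of "a + (i - 1) * pi" "b + (i - 1) * pi"]
    by (simp add: algebra_simps)
qed

lemma nn_integral_angle_proj_multiple:
  fixes N :: nat
  assumes "compact E"
  shows "(\<integral>\<^sup>+\<theta>\<in>{0..N * pi}. emeasure lborel (angle_proj \<theta> ` E) \<partial>lborel)
    \<le> of_nat N * favard_length E"
proof (induction N)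
  case 0
  have "(\<integral>\<^sup>+\<theta>\<in>{0}. emeasure lborel (angle_proj \<theta> ` E) \<partial>lborel) = 0"
    by (subst nn_integral_0_iff_AE) 
       (use borel_measurable_emeasure_angle_proj[OF assms] AE_lborel_singleton[of 0] in \<open>auto\<close>)
  then show ?case by simp
next
  case (Suc N)
  note [measurable] = borel_measurable_emeasure_angle_proj[OF assms]
  let ?F = "\<lambda>\<theta>. emeasure lborel (angle_proj \<theta> ` E)"
  \<comment> \<open>The two intervals overlap in an endpoint, hence only an inequality. The second
    is written as an integer shift of \<open>{0..pi}\<close>, ready for periodicity.\<close>
  have "(\<integral>\<^sup>+\<theta>\<in>{0..Suc N * pi}. ?F \<theta> \<partial>lborel)
      \<le> (\<integral>\<^sup>+\<theta>. ?F \<theta> * indicator {0..N * pi} \<theta>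
          + ?F \<theta> * indicator {0 + int N * pi..pi + int N * pi} \<theta> \<partial>lborel)"
    by (intro nn_integral_mono) (auto simp: indicator_def algebra_simps)
  also have "\<dots> = (\<integral>\<^sup>+\<theta>\<in>{0..N * pi}. ?F \<theta> \<partial>lborel)
      + (\<integral>\<^sup>+\<theta>\<in>{0 + int N * pi..pi + int N * pi}. ?F \<theta> \<partial>lborel)"
    by (intro nn_integral_add) auto
  also have "\<dots> \<le> of_nat N * favard_length E + favard_length E"
    by (subst nn_integral_angle_proj_shift[OF assms])
       (intro add_mono Suc.IH eq_refl favard_length_lborel[OF assms, symmetric])
  finally show ?case by (simp add: algebra_simps)
qed

text \<open>The range is covered by whole periods starting at the last multiple of \<open>pi\<close>
  not exceeding \<open>a\<close>. Since \<open>a\<close> may fall inside a period, this can take one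
  period more than the length suggests; hence \<open>real N - 1\<close>.\<close>

lemma nn_integral_angle_proj_le:
  fixes N :: nat
  assumes E: "compact E" and N: "b - a \<le> (real N - 1) * pi"
  shows "(\<integral>\<^sup>+\<theta>\<in>{a..b}. emeasure lborel (angle_proj \<theta> ` E) \<partial>lborel) \<le> of_nat N * favard_length E"
proof -
  define k where "k = \<lfloor>a / pi\<rfloor>"
  have "real_of_int k \<le> a / pi" "a / pi < real_of_int k + 1"
    unfolding k_def by linarith+
  then have k: "k * pi \<le> a" "a \<le> (k + 1) * pi"
    by (auto simp: field_simps)
  have "b \<le> (k + 1) * pi + (real N - 1) * pi" using k(2) N by linarith
  then have "{a..b} \<subseteq> {0 + k * pi..N * pi + k * pi}"
    using k(1) by (auto simp: algebra_simps)
  then have "(\<integral>\<^sup>+\<theta>\<in>{a..b}. emeasure lborel (angle_proj \<theta> ` E) \<partial>lborel)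
     \<le> (\<integral>\<^sup>+\<theta>\<in>{0 + k * pi..N * pi + k * pi}. emeasure lborel (angle_proj \<theta> ` E) \<partial>lborel)"
    by (intro nn_integral_mono mult_left_mono) (auto simp: indicator_def)
  then show ?thesis
    using nn_integral_angle_proj_multiple[OF E, of N]
    unfolding nn_integral_angle_proj_shift[OF E] by (rule order_trans)
qed

text \<open>Nonnegativity of \<open>f\<close> turns the change of variables for absolutely
  integrable functions into an equality of \<open>ennreal\<close> integrals, the form in which the
  Favard lengths are given.\<close>

lemma nn_integral_injective_substitution:
  fixes g g' f :: "real \<Rightarrow> real"
  assumes S: "S \<in> sets lebesgue"
    and g: "\<And>x. x \<in> S \<Longrightarrow> (g has_field_derivative g' x) (at x within S)" "inj_on g S"
    and f: "f absolutely_integrable_on g ` S" "\<And>x. 0 \<le> f x"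
  shows "(\<integral>\<^sup>+x\<in>S. ennreal (\<bar>g' x\<bar> * f (g x)) \<partial>lborel) = (\<integral>\<^sup>+y\<in>g ` S. ennreal (f y) \<partial>lborel)"
proof -
  have "(\<lambda>x. \<bar>g' x\<bar> * f (g x)) absolutely_integrable_on S \<and>
      integral S (\<lambda>x. \<bar>g' x\<bar> * f (g x)) = integral (g ` S) f"
    using f(1) by (subst has_absolute_integral_change_of_variables_1'[OF S g]) auto
  then have 1: "((\<lambda>x. \<bar>g' x\<bar> * f (g x)) has_integral integral (g ` S) f) S"
    using set_lebesgue_integral_eq_integral(1) by (metis integrable_integral)
  have 2: "(f has_integral integral (g ` S) f) (g ` S)"
    using f(1) set_lebesgue_integral_eq_integral(1) integrable_integral by blast
  show ?thesis
    using nn_integral_has_integral_lebesgue'[OF _ 1] nn_integral_has_integral_lebesgue'[OF _ 2] f(2)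
    by simp
qed

text \<open>Since \<open>1 \<le> M * \<bar>\<theta>' t\<bar>\<close>, the Jacobian can be inserted
  at the cost of a factor \<open>M\<close>. As \<open>\<theta>'\<close> has no zero, the mean value
  theorem makes \<theta> injective, so each angle is counted once; the upper bound on
  \<open>\<bar>\<theta>'\<bar>\<close> confines the angles to a range covered by \<open>N\<close>
  periods.\<close>

lemma nn_integral_angle_proj_curve_le:
  fixes \<theta> \<theta>' :: "real \<Rightarrow> real" and N :: nat
  assumes E: "compact E"
    and \<theta>: "\<And>t. t \<in> {a<..<b} \<Longrightarrow> (\<theta> has_real_derivative \<theta>' t) (at t)"
    and low: "\<And>t. t \<in> {a<..<b} \<Longrightarrow> inverse M \<le> \<bar>\<theta>' t\<bar>"
    and up: "\<And>t. t \<in> {a<..<b} \<Longrightarrow> \<bar>\<theta>' t\<bar> \<le> M"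
    and M: "0 < M" and N: "2 * M * (b - a) \<le> (real N - 1) * pi"
  shows "(\<integral>\<^sup>+t\<in>{a<..<b}. emeasure lebesgue (angle_proj (\<theta> t) ` E) \<partial>lebesgue)
    \<le> ennreal (M * N) * favard_length E"
proof (cases "a < b")
  case True
  let ?J = "{a<..<b}"
  \<comment> \<open>The substitution is made for real-valued functions; compactness of
    \<open>E\<close> keeps all these lengths finite.\<close>
  define F where "F \<phi> = measure lborel (angle_proj \<phi> ` E)" for \<phi>
  have F: "emeasure lborel (angle_proj \<phi> ` E) = ennreal (F \<phi>)" for \<phi>
    unfolding F_def
    by (intro emeasure_eq_ennreal_measure less_imp_neq emeasure_compact_finite[THEN less_le_trans]
        compact_angle_proj E) simp
  have F0: "0 \<le> F \<phi>" for \<phi> by (simp add: F_def)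
  have Fm[measurable]: "F \<in> borel_measurable borel"
    unfolding F_def measure_def using borel_measurable_emeasure_angle_proj[OF E] by measurable
  obtain B where B: "\<And>x. x \<in> E \<Longrightarrow> norm x \<le> B" "0 < B"
    using compact_imp_bounded[OF E] by (metis bounded_pos)
  have FB: "F \<phi> \<le> 2 * B" for \<phi>
  proof -
    have "angle_proj \<phi> ` E \<subseteq> {- B..B}"
    proof (intro image_subsetI)
      fix x assume "x \<in> E"
      then show "angle_proj \<phi> x \<in> {- B..B}"
        using B(1)[of x] abs_angle_proj_le[of \<phi> x] unfolding atLeastAtMost_iff by linarith
    qed
    then have "F \<phi> \<le> measure lborel {- B..B}"
      unfolding F_def by (intro measure_mono_fmeasurable)
        (auto intro!: borel_compact compact_angle_proj E fmeasurable_compact)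
    then show ?thesis using B by simp
  qed
  have mvt: "\<exists>z\<in>?J. \<theta> y - \<theta> x = (y - x) * \<theta>' z" if "x \<in> ?J" "y \<in> ?J" "x < y" for x y
    using MVT2[of x y \<theta> \<theta>'] \<theta> that by fastforce
  have inj: "inj_on \<theta> ?J"
  proof (rule linorder_inj_onI)
    fix x y assume "x < y" "x \<in> ?J" "y \<in> ?J"
    then obtain z where "z \<in> ?J" "\<theta> y - \<theta> x = (y - x) * \<theta>' z" using mvt by blast
    moreover have "\<theta>' z \<noteq> 0" using low[OF \<open>z \<in> ?J\<close>] M by auto
    ultimately show "\<theta> x \<noteq> \<theta> y" using \<open>x < y\<close> by auto
  qed auto
  define t0 where "t0 = (a + b) / 2"
  have t0: "t0 \<in> ?J" using True by (auto simp: t0_def)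
  \<comment> \<open>By the mean value theorem \<theta> stays within \<open>M * (b - a)\<close> of
    its value at \<open>t0\<close>; the resulting length \<open>2 * M * (b - a)\<close> is the
    quantity that \<open>N\<close> controls.\<close>
  define A where "A = \<theta> t0 - M * (b - a)"
  define B' where "B' = \<theta> t0 + M * (b - a)"
  have sub: "\<theta> ` ?J \<subseteq> {A..B'}"
  proof
    fix y assume "y \<in> \<theta> ` ?J"
    then obtain t where t: "t \<in> ?J" "y = \<theta> t" by blast
    have "\<bar>\<theta> t - \<theta> t0\<bar> \<le> M * (b - a)"
    proof -
      have "\<exists>z\<in>?J. \<bar>\<theta> t - \<theta> t0\<bar> = \<bar>t - t0\<bar> * \<bar>\<theta>' z\<bar>"
      proof (cases t t0 rule: linorder_cases)
        case less
        then show ?thesis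
          using mvt[OF t(1) t0] by (metis abs_minus_commute abs_mult)
      next
        case greater
        then show ?thesis
          using mvt[OF t0 t(1)] by (metis abs_mult)
      qed (use t in auto)
      then obtain z where z: "z \<in> ?J" "\<bar>\<theta> t - \<theta> t0\<bar> = \<bar>t - t0\<bar> * \<bar>\<theta>' z\<bar>" by blast
      have "\<bar>t - t0\<bar> * \<bar>\<theta>' z\<bar> \<le> (b - a) * M"
        using up[OF z(1)] t(1) t0 by (intro mult_mono) auto
      with z(2) show ?thesis by (simp add: mult.commute)
    qed
    then show "y \<in> {A..B'}" unfolding t(2) A_def B'_def by auto
  qed
  have cont: "continuous_on ?J \<theta>"
    using \<theta> by (intro continuous_at_imp_continuous_on) (blast intro: DERIV_isCont)
  have "is_interval (\<theta> ` ?J)"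
    using connected_continuous_image[OF cont] by (simp add: is_interval_connected_1)
  then have bor: "\<theta> ` ?J \<in> sets borel"
    by (auto dest!: is_real_interval)
  \<comment> \<open>Finite measure of the range makes the constant \<open>2 * B\<close> integrable
    there, and so the bounded \<open>F\<close> absolutely integrable.\<close>
  have lm: "\<theta> ` ?J \<in> lmeasurable"
  proof (rule fmeasurableI2)
    show "{A..B'} \<in> lmeasurable" by simp
  qed (use sub bor in auto)
  have abs: "F absolutely_integrable_on \<theta> ` ?J"
  proof (rule measurable_bounded_by_integrable_imp_absolutely_integrable)
    show "F \<in> borel_measurable (lebesgue_on (\<theta> ` ?J))"
      by (intro measurable_restrict_space1 measurable_completion) simp
    show "(\<lambda>_. 2 * B) integrable_on \<theta> ` ?J"
      using lm by (rule integrable_on_const)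
  qed (use bor FB in \<open>auto simp: F_def\<close>)
  have "(\<integral>\<^sup>+t\<in>?J. emeasure lebesgue (angle_proj (\<theta> t) ` E) \<partial>lebesgue)
      = (\<integral>\<^sup>+t\<in>?J. ennreal (F (\<theta> t)) \<partial>lborel)"
    by (simp add: nn_integral_completion emeasure_angle_proj_lborel[OF E] F)
  also have "\<dots> \<le> (\<integral>\<^sup>+t\<in>?J. ennreal (\<bar>\<theta>' t\<bar> * (M * F (\<theta> t))) \<partial>lborel)"
  proof (rule nn_integral_mono)
    fix t
    have "ennreal (F (\<theta> t)) \<le> ennreal (\<bar>\<theta>' t\<bar> * (M * F (\<theta> t)))" if "t \<in> ?J"
    proof (rule ennreal_leI)
      have "1 * F (\<theta> t) \<le> (M * \<bar>\<theta>' t\<bar>) * F (\<theta> t)"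
        using low[OF that] M by (intro mult_right_mono) (auto simp: F_def field_simps)
      then show "F (\<theta> t) \<le> \<bar>\<theta>' t\<bar> * (M * F (\<theta> t))" by (simp add: mult_ac)
    qed
    then show "ennreal (F (\<theta> t)) * indicator ?J t
        \<le> ennreal (\<bar>\<theta>' t\<bar> * (M * F (\<theta> t))) * indicator ?J t"
      by (auto simp: indicator_def)
  qed
  also have "\<dots> = (\<integral>\<^sup>+y\<in>\<theta> ` ?J. ennreal (M * F y) \<partial>lborel)"
    using \<theta> inj abs M
    by (intro nn_integral_injective_substitution)
       (auto simp: F0 intro: has_field_derivative_at_within)
  also have "\<dots> = ennreal M * (\<integral>\<^sup>+y\<in>\<theta> ` ?J. ennreal (F y) \<partial>lborel)"
    using M bor Fm
    by (subst nn_integral_cmult[symmetric]) (auto simp: ennreal_mult F0 mult.assoc)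
  also have "(\<integral>\<^sup>+y\<in>\<theta> ` ?J. ennreal (F y) \<partial>lborel)
      \<le> (\<integral>\<^sup>+y\<in>{A..B'}. emeasure lborel (angle_proj y ` E) \<partial>lborel)"
    using sub by (intro nn_integral_mono) (auto simp: F indicator_def)
  also have "\<dots> \<le> of_nat N * favard_length E"
    using N by (intro nn_integral_angle_proj_le[OF E]) (simp add: A_def B'_def algebra_simps)
  finally show ?thesis
    using M by (simp add: ennreal_mult ennreal_of_nat_eq_real_of_nat mult.assoc mult_left_mono)
qed simp

subsection \<open>Polar angle, slices of \<open>C\<^sup>2\<close> functions and Taylor's formula\<close>

text \<open>Rather than inverting trigonometric functions piecewise, \<theta> is obtained by
  integrating the derivative that a polar angle must have, with the constant of integration fixed by
  a polar angle at the midpoint. Continuity of \<open>g'\<close> and \<open>h'\<close> provides the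
  antiderivative.\<close>

lemma polar_angle_lift:
  fixes g h g' h' :: "real \<Rightarrow> real"
  assumes ab: "a < b"
    and g: "\<And>t. t \<in> {a<..<b} \<Longrightarrow> (g has_real_derivative g' t) (at t)"
    and h: "\<And>t. t \<in> {a<..<b} \<Longrightarrow> (h has_real_derivative h' t) (at t)"
    and cont: "continuous_on {a<..<b} g'" "continuous_on {a<..<b} h'"
    and nz: "\<And>t. t \<in> {a<..<b} \<Longrightarrow> 0 < (g t)\<^sup>2 + (h t)\<^sup>2"
  obtains \<theta> where
    "\<And>t. t \<in> {a<..<b} \<Longrightarrow>
      (\<theta> has_real_derivative (g t * h' t - h t * g' t) / ((g t)\<^sup>2 + (h t)\<^sup>2)) (at t)"
    "\<And>t. t \<in> {a<..<b} \<Longrightarrow> g t = sqrt ((g t)\<^sup>2 + (h t)\<^sup>2) * cos (\<theta> t)"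
    "\<And>t. t \<in> {a<..<b} \<Longrightarrow> h t = sqrt ((g t)\<^sup>2 + (h t)\<^sup>2) * sin (\<theta> t)"
proof -
  let ?J = "{a<..<b}"
  define n where "n t = (g t)\<^sup>2 + (h t)\<^sup>2" for t
  define w where "w t = (g t * h' t - h t * g' t) / n t" for t
  have n: "0 < n t" if "t \<in> ?J" for t using nz[OF that] by (simp add: n_def)
  have "continuous_on ?J w"
    unfolding w_def n_def using nz
    by (intro continuous_intros cont continuous_at_imp_continuous_on)
       (auto intro!: DERIV_isCont g h dest!: nz[unfolded greaterThanLessThan_iff, OF conjI])
  then have "isCont w t" if "t \<in> ?J" for t
    using that by (simp add: continuous_on_eq_continuous_at)
  then obtain F where F: "\<And>t. t \<in> ?J \<Longrightarrow> (F has_real_derivative w t) (at t)"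
    using einterval_antiderivative[of "ereal a" "ereal b" w] ab
    by (auto simp: has_real_derivative_iff_has_vector_derivative)
  define t0 where "t0 = (a + b) / 2"
  have t0: "t0 \<in> ?J" using ab by (auto simp: t0_def)
  have "(g t0 / sqrt (n t0))\<^sup>2 + (h t0 / sqrt (n t0))\<^sup>2 = 1"
    using n[OF t0] by (simp add: power_divide add_divide_distrib[symmetric]) (simp add: n_def)
  then obtain \<phi> where \<phi>: "g t0 / sqrt (n t0) = cos \<phi>" "h t0 / sqrt (n t0) = sin \<phi>"
    using sincos_total_2pi by metis
  define \<theta> where "\<theta> t = F t - F t0 + \<phi>" for t
  have \<theta>: "(\<theta> has_real_derivative w t) (at t)" if "t \<in> ?J" for t
    unfolding \<theta>_def using F[OF that] by (auto intro!: derivative_eq_intros)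
  \<comment> \<open>the cosine of the angle between \<open>(g, h)\<close> and \<open>(cos \<theta>, sin \<theta>)\<close>, which starts at \<open>1\<close> and stays constant\<close>
  define c where "c t = (g t * cos (\<theta> t) + h t * sin (\<theta> t)) / sqrt (n t)" for t
  have "(c has_real_derivative 0) (at t)" if t: "t \<in> ?J" for t
  proof -
    define e where "e = g t * cos (\<theta> t) + h t * sin (\<theta> t)"
    define e' where "e' = g' t * cos (\<theta> t) + h' t * sin (\<theta> t)
      + w t * (h t * cos (\<theta> t) - g t * sin (\<theta> t))"
    define q where "q = g t * g' t + h t * h' t"
    have e: "((\<lambda>t. g t * cos (\<theta> t) + h t * sin (\<theta> t)) has_real_derivative e') (at t)"
      unfolding e'_def using g[OF t] h[OF t] \<theta>[OF t]
      by (auto intro!: derivative_eq_intros simp: algebra_simps)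
    have "(n has_real_derivative 2 * q) (at t)"
      unfolding n_def q_def using g[OF t] h[OF t]
      by (auto intro!: derivative_eq_intros simp: algebra_simps)
    then have s: "((\<lambda>t. sqrt (n t)) has_real_derivative q / sqrt (n t)) (at t)"
      using n[OF t] by (auto intro!: derivative_eq_intros simp: field_simps)
    \<comment> \<open>Multiplying by \<open>n t\<close> clears the denominator of
      \<open>w t\<close>. The outcome \<open>n t * e' = e * q\<close> is the linear differential
      equation that the square root of \<open>n\<close> satisfies too, so the quotient
      \<open>c\<close> is stationary.\<close>
    have "n t * e' = n t * (g' t * cos (\<theta> t) + h' t * sin (\<theta> t))
        + (n t * w t) * (h t * cos (\<theta> t) - g t * sin (\<theta> t))"
      by (simp add: e'_def algebra_simps)
    also have "n t * w t = g t * h' t - h t * g' t"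
      using n[OF t] by (simp add: w_def)
    finally have "n t * e' = e * q"
      by (simp add: n_def q_def e_def power2_eq_square algebra_simps)
    then have "e' * sqrt (n t) - e * (q / sqrt (n t)) = 0"
      using n[OF t] by (simp add: field_simps)
    then show ?thesis
      unfolding c_def using DERIV_quotient[OF e s] n[OF t] by (simp add: e_def)
  qed
  then have "c t = c t0" if "t \<in> ?J" for t
    using DERIV_isconst3[OF ab that t0] by blast
  moreover have "c t0 = (g t0 / sqrt (n t0)) * cos \<phi> + (h t0 / sqrt (n t0)) * sin \<phi>"
    by (simp add: c_def \<theta>_def add_divide_distrib)
  then have "c t0 = 1" unfolding \<phi> by (simp flip: power2_eq_square)
  ultimately have c1: "c t = 1" if "t \<in> ?J" for t
    using that by simp
  have c: "g t * cos (\<theta> t) + h t * sin (\<theta> t) = sqrt (n t)" if "t \<in> ?J" for t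
    using c1[OF that, unfolded c_def] n[OF that] by (simp add: divide_eq_eq)
  have "g t = sqrt (n t) * cos (\<theta> t) \<and> h t = sqrt (n t) * sin (\<theta> t)" if "t \<in> ?J" for t
  proof -
    define x y where "x = cos (\<theta> t)" and "y = sin (\<theta> t)"
    have xy: "x\<^sup>2 + y\<^sup>2 = 1" by (simp add: x_def y_def)
    \<comment> \<open>Equality case of Cauchy-Schwarz: the squared distance from
      \<open>(g t, h t)\<close> to \<open>sqrt (n t)\<close> times the unit vector is
      \<open>n t + n t - 2 * n t\<close>.\<close>
    have "(g t - sqrt (n t) * x)\<^sup>2 + (h t - sqrt (n t) * y)\<^sup>2
        = (g t)\<^sup>2 + (h t)\<^sup>2 + (sqrt (n t))\<^sup>2 * (x\<^sup>2 + y\<^sup>2) - 2 * sqrt (n t) * (g t * x + h t * y)"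
      by (simp add: power2_eq_square algebra_simps)
    also have "\<dots> = 0"
      unfolding xy c[OF that, folded x_def y_def] using n[OF that]
      by (simp add: mult.assoc) (simp add: n_def)
    finally show ?thesis by (simp add: x_def y_def sum_power2_eq_zero_iff)
  qed
  then show ?thesis
    using that[of \<theta>] \<theta> unfolding w_def n_def by blast
qed

lemma partial_deriv_eq:
  fixes f :: "real ^ 'n::finite \<Rightarrow> real"
  assumes "(f has_derivative f') (at x)"
  shows "partial_deriv i f x = f' (axis i 1)"
proof -
  have "((\<lambda>t. f (x + t *\<^sub>R axis i 1)) has_derivative (\<lambda>t. f' (t *\<^sub>R axis i 1))) (at 0)"
    by (rule has_derivative_compose[of "\<lambda>t. x + t *\<^sub>R axis i 1" "\<lambda>t. t *\<^sub>R axis i 1" 0 UNIV f f'])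
       (auto intro!: derivative_eq_intros assms)
  moreover have "f' (t *\<^sub>R axis i 1) = f' (axis i 1) * t" for t
    using linear_scale[OF has_derivative_linear[OF assms]] by simp
  ultimately have "((\<lambda>t. f (x + t *\<^sub>R axis i 1)) has_real_derivative f' (axis i 1)) (at 0)"
    by (simp add: has_field_derivative_def mult.commute[of _ "f' (axis i 1)"])
  then show ?thesis unfolding partial_deriv_def by (rule DERIV_imp_deriv)
qed

text \<open>Meant for second partial derivatives: the inner one is known in terms of the Frechet
  derivative only on \<open>U\<close>, but \<open>deriv\<close> sees no more than a
  neighbourhood.\<close>

lemma partial_deriv_cong_open:
  assumes "open U" "x \<in> U" "\<And>y. y \<in> U \<Longrightarrow> f y = g y"
  shows "partial_deriv i f x = partial_deriv i g x"
proof -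
  have "((\<lambda>t. x + t *\<^sub>R axis i 1) \<longlongrightarrow> x + 0 *\<^sub>R axis i 1) (nhds (0::real))"
    by (intro tendsto_intros filterlim_ident)
  then have "eventually (\<lambda>t. x + t *\<^sub>R axis i 1 \<in> U) (nhds (0::real))"
    using assms(1,2) by (auto dest!: topological_tendstoD)
  then have "eventually (\<lambda>t. f (x + t *\<^sub>R axis i 1) = g (x + t *\<^sub>R axis i 1)) (nhds (0::real))"
    by eventually_elim (rule assms(3))
  then show ?thesis unfolding partial_deriv_def by (rule deriv_cong_ev) simp
qed

text \<open>\<open>D\<close> and \<open>H\<close> are the first and second derivatives in \<open>x\<close>, \<open>P\<close> is the mixed one.\<close>

lemma C2_on_slice_derivs:
  fixes \<Phi> :: "real \<Rightarrow> 'a::euclidean_space \<Rightarrow> real"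
  assumes "C2_on (\<lambda>(\<alpha>, x). \<Phi> \<alpha> x) (I \<times> U)"
  obtains D H P where
    "\<And>\<alpha> x. \<alpha> \<in> I \<Longrightarrow> x \<in> U \<Longrightarrow> (\<Phi> \<alpha> has_derivative D \<alpha> x) (at x)"
    "\<And>\<alpha> x w. \<alpha> \<in> I \<Longrightarrow> x \<in> U \<Longrightarrow> ((\<lambda>y. D \<alpha> y w) has_derivative (\<lambda>v. H \<alpha> x v w)) (at x)"
    "\<And>\<alpha> x. bilinear (H \<alpha> x)"
    "\<And>\<alpha> x w. \<alpha> \<in> I \<Longrightarrow> x \<in> U \<Longrightarrow> ((\<lambda>\<beta>. D \<beta> x w) has_real_derivative P \<alpha> x w) (at \<alpha>)"
    "\<And>x w. x \<in> U \<Longrightarrow> continuous_on I (\<lambda>\<alpha>. P \<alpha> x w)"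
proof -
  obtain f' :: "real \<times> 'a \<Rightarrow> (real \<times> 'a) \<Rightarrow>\<^sub>L real"
    and f'' :: "real \<times> 'a \<Rightarrow> (real \<times> 'a) \<Rightarrow>\<^sub>L ((real \<times> 'a) \<Rightarrow>\<^sub>L real)"
    where f': "\<And>z. z \<in> I \<times> U \<Longrightarrow> ((\<lambda>(\<alpha>, x). \<Phi> \<alpha> x) has_derivative blinfun_apply (f' z)) (at z)"
      and f'': "\<And>z. z \<in> I \<times> U \<Longrightarrow> (f' has_derivative blinfun_apply (f'' z)) (at z)"
      and cont: "continuous_on (I \<times> U) f''"
    using assms unfolding C2_on_def by blast
  have w: "((\<lambda>z. blinfun_apply (f' z) w) has_derivative (\<lambda>v. f'' z v w)) (at z)"
    if "z \<in> I \<times> U" for z w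
    using bounded_linear.has_derivative[OF blinfun.bounded_linear_left f''[OF that]] by simp
  have emb: "bounded_linear (\<lambda>v :: 'a. (0 :: real, v))"
    by (rule bounded_linear_Pair[OF bounded_linear_zero bounded_linear_ident])
  show ?thesis
  \<comment> \<open>The slot \<open>(0, v)\<close> selects a spatial direction and
    \<open>(1, 0)\<close> the parameter direction. The first argument of \<open>f''\<close> is the
    direction of the outer differentiation.\<close>
  proof (rule that[of "\<lambda>\<alpha> x v. f' (\<alpha>, x) (0, v)" "\<lambda>\<alpha> x v w. f'' (\<alpha>, x) (0, v) (0, w)"
        "\<lambda>\<alpha> x w. f'' (\<alpha>, x) (1, 0) (0, w)"])
    fix \<alpha> x w assume \<alpha>: "\<alpha> \<in> I" and x: "x \<in> U"
    have i: "((\<lambda>y. (\<alpha>, y)) has_derivative (\<lambda>v. (0, v))) (at x)"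
      by (auto intro!: derivative_eq_intros)
    have j: "((\<lambda>\<beta>. (\<beta>, x)) has_derivative (\<lambda>t. (t, 0))) (at \<alpha>)"
      by (auto intro!: derivative_eq_intros)
    show "(\<Phi> \<alpha> has_derivative (\<lambda>v. f' (\<alpha>, x) (0, v))) (at x)"
      using has_derivative_compose[OF i f'[of "(\<alpha>, x)"]] \<alpha> x by simp
    show "((\<lambda>y. f' (\<alpha>, y) (0, w)) has_derivative (\<lambda>v. f'' (\<alpha>, x) (0, v) (0, w))) (at x)"
      using has_derivative_compose[OF i w[of "(\<alpha>, x)" "(0, w)"]] \<alpha> x by simp
    have "f'' (\<alpha>, x) (t, 0) (0, w) = f'' (\<alpha>, x) (1, 0) (0, w) * t" for t
      using blinfun.scaleR_right[of "f'' (\<alpha>, x)" t "(1, 0)"] by (simp add: blinfun.scaleR_left)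
    then have "(\<lambda>t. f'' (\<alpha>, x) (t, 0) (0, w)) = (*) (f'' (\<alpha>, x) (1, 0) (0, w))"
      by blast
    moreover have "((\<lambda>\<beta>. f' (\<beta>, x) (0, w)) has_derivative (\<lambda>t. f'' (\<alpha>, x) (t, 0) (0, w))) (at \<alpha>)"
      using has_derivative_compose[OF j w[of "(\<alpha>, x)" "(0, w)"]] \<alpha> x by simp
    ultimately show "((\<lambda>\<beta>. f' (\<beta>, x) (0, w)) has_real_derivative f'' (\<alpha>, x) (1, 0) (0, w)) (at \<alpha>)"
      by (simp only: has_field_derivative_def)
  next
    fix \<alpha> x
    show "bilinear (\<lambda>v w. blinfun_apply (blinfun_apply (f'' (\<alpha>, x)) (0, v)) (0, w))"
      unfolding bilinear_def
    proof (intro conjI allI)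
      fix v
      show "linear (\<lambda>w. f'' (\<alpha>, x) (0, v) (0, w))"
        using bounded_linear_compose[OF blinfun.bounded_linear_right[of "f'' (\<alpha>, x) (0, v)"] emb]
        by (rule bounded_linear.linear)
      have "bounded_linear (\<lambda>v'. f'' (\<alpha>, x) (0, v'))"
        by (rule bounded_linear_compose[OF blinfun.bounded_linear_right emb])
      from bounded_linear_compose[OF blinfun.bounded_linear_left[of "(0, v)"] this]
      show "linear (\<lambda>v'. f'' (\<alpha>, x) (0, v') (0, v))"
        by (rule bounded_linear.linear)
    qed
  next
    fix x w assume x: "x \<in> U"
    have "continuous_on I (\<lambda>\<alpha>. f'' (\<alpha>, x))"
      by (rule continuous_on_compose2[OF cont continuous_on_Pair[OF continuous_on_id continuous_on_const]])
         (use x in auto)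
    then show "continuous_on I (\<lambda>\<alpha>. f'' (\<alpha>, x) (1, 0) (0, w))"
      by (intro bounded_linear.continuous_on[OF blinfun.bounded_linear_left])
  qed
qed

text \<open>Maclaurin's formula of order 2 with Lagrange remainder, applied to \<open>f\<close>
  along the segment parametrised by the unit interval. The squared length of \<open>y - p\<close> is
  already contained in \<open>B\<close>.\<close>

lemma Taylor_quadratic_segment:
  fixes f :: "'a::real_normed_vector \<Rightarrow> real"
  assumes f: "\<And>x. x \<in> closed_segment p y \<Longrightarrow> (f has_derivative D x) (at x)"
    and D: "\<And>x. x \<in> closed_segment p y \<Longrightarrow>
      ((\<lambda>z. D z (y - p)) has_derivative (\<lambda>v. H x v (y - p))) (at x)"
    and H: "\<And>x. x \<in> closed_segment p y \<Longrightarrow> \<bar>H x (y - p) (y - p)\<bar> \<le> B"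
  shows "\<bar>f y - f p - D p (y - p)\<bar> \<le> B / 2"
proof -
  define v where "v = y - p"
  have seg: "p + t *\<^sub>R v \<in> closed_segment p y" if "0 \<le> t" "t \<le> 1" for t
    using that by (auto simp: closed_segment_def v_def algebra_simps intro!: exI[of _ t])
  have l: "((\<lambda>t. p + t *\<^sub>R v) has_derivative (\<lambda>t. t *\<^sub>R v)) (at t)" for t
    by (auto intro!: derivative_eq_intros)
  have comp: "((\<lambda>t. k (p + t *\<^sub>R v)) has_real_derivative k' v) (at t)"
    if k: "(k has_derivative k') (at (p + t *\<^sub>R v))" for k :: "'a \<Rightarrow> real" and k' t
    using has_derivative_compose[OF l k] linear_scale[OF has_derivative_linear[OF k]]
    by (simp add: has_field_derivative_def mult.commute[of _ "k' v"])
  define diff where "diff m t =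
    (if m = 0 then f (p + t *\<^sub>R v) else if m = 1 then D (p + t *\<^sub>R v) v else H (p + t *\<^sub>R v) v v)"
    for m :: nat and t
  have "\<forall>m t. m < 2 \<and> 0 \<le> t \<and> t \<le> 1 \<longrightarrow> DERIV (diff m) t :> diff (Suc m) t"
  proof safe
    fix m :: nat and t :: real assume "m < 2" and t: "0 \<le> t" "t \<le> 1"
    then consider "m = 0" | "m = 1" by linarith
    then show "DERIV (diff m) t :> diff (Suc m) t"
    proof cases
      case 1
      then show ?thesis using comp[OF f[OF seg[OF t]]] by (simp add: diff_def[abs_def])
    next
      case 2
      then show ?thesis
        using comp[OF D[OF seg[OF t], folded v_def]] by (simp add: diff_def[abs_def])
    qed
  qed
  then obtain t where t: "0 < t" "t \<le> 1"
    "diff 0 1 = (\<Sum>m<2. diff m 0 / fact m * 1 ^ m) + diff 2 t / fact 2 * 1 ^ 2"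
    using Maclaurin2[of 1 diff "diff 0" 2] by auto
  have "f y - f p - D p v = H (p + t *\<^sub>R v) v v / 2"
    using t(3) by (simp add: diff_def numeral_2_eq_2 v_def)
  then have "\<bar>f y - f p - D p v\<bar> = \<bar>H (p + t *\<^sub>R v) v v\<bar> / 2" by (simp only: abs_divide abs_numeral)
  then show ?thesis using H[OF seg[of t], folded v_def] t unfolding v_def by linarith
qed

text \<open>Expansion in the standard basis gives four terms, and each coordinate is at most the
  norm.\<close>

lemma bilinear_bound_vec2:
  fixes H :: "real ^ 2 \<Rightarrow> real ^ 2 \<Rightarrow> real"
  assumes H: "bilinear H" and B: "\<And>i j. \<bar>H (axis i 1) (axis j 1)\<bar> \<le> B"
  shows "\<bar>H v w\<bar> \<le> 4 * B * norm v * norm w"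
proof -
  have ex: "u = u $ 1 *\<^sub>R axis 1 1 + u $ 2 *\<^sub>R axis 2 1" for u :: "real ^ 2"
    by (simp add: vec_eq_iff forall_2 axis_def)
  have "H v w = (\<Sum>i\<in>UNIV. \<Sum>j\<in>UNIV. v $ i * w $ j * H (axis i 1) (axis j 1))"
    by (subst ex[of v], subst ex[of w])
       (simp add: sum_2 bilinear_ladd[OF H] bilinear_radd[OF H] bilinear_lmul[OF H]
         bilinear_rmul[OF H] algebra_simps)
  also have "\<bar>\<dots>\<bar> \<le> (\<Sum>i\<in>(UNIV :: 2 set). \<Sum>j\<in>(UNIV :: 2 set). norm v * norm w * B)"
    by (intro order_trans[OF sum_abs] sum_mono)
       (auto simp: abs_mult intro!: mult_mono component_le_norm_cart B)
  finally show ?thesis by (simp add: sum_2 mult_ac)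
qed

lemma open_bounded_interval_eq:
  fixes I :: "real set"
  assumes "open I" "bounded I" "is_interval I" "I \<noteq> {}"
  obtains a b where "a < b" "I = {a<..<b}"
proof -
  have bdd: "bdd_below I" "bdd_above I"
    using assms(2) by (auto intro: bounded_imp_bdd_below bounded_imp_bdd_above)
  have eq: "I = {Inf I<..<Sup I}"
  proof (intro set_eqI iffI)
    fix x assume x: "x \<in> I"
    then obtain e where e: "0 < e" "cball x e \<subseteq> I"
      using assms(1) open_contains_cball by blast
    then have "x - e \<in> I" "x + e \<in> I" by (auto simp: dist_real_def subset_iff)
    then have "Inf I \<le> x - e" "x + e \<le> Sup I"
      using bdd by (auto intro: cInf_lower cSup_upper)
    with e(1) show "x \<in> {Inf I<..<Sup I}" by simp
  next
    fix x assume "x \<in> {Inf I<..<Sup I}"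
    then obtain y z where "y \<in> I" "y < x" "z \<in> I" "x < z"
      using cInf_lessD[OF assms(4), of x] less_cSupD[OF assms(4), of x]
      unfolding greaterThanLessThan_iff by blast
    then show "x \<in> I" using assms(3) unfolding is_interval_1 by (meson less_imp_le)
  qed
  then have "Inf I < Sup I" using assms(4) by force
  with eq show ?thesis by (rule that[rotated])
qed

subsection \<open>Comparison of the Favard lengths\<close>

theorem theorem2p2:
  fixes I :: "real set" and U V :: "(real ^ 2) set"
    and \<Phi> :: "real \<Rightarrow> real ^ 2 \<Rightarrow> real" and C\<^sub>0 :: real
  assumes I: "open I" "bounded I" "is_interval I"
    and U: "open U"
    and C2: "C2_on (\<lambda>(\<alpha>, x). \<Phi> \<alpha> x) (I \<times> U)"
    and C0: "C\<^sub>0 \<ge> 1"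
    and grad: "\<And>\<alpha> x. \<alpha> \<in> I \<Longrightarrow> x \<in> U \<Longrightarrow>
        inverse C\<^sub>0 \<le> norm (gradient (\<Phi> \<alpha>) x) \<and> norm (gradient (\<Phi> \<alpha>) x) \<le> C\<^sub>0"
    and second: "\<And>\<alpha> x i j. \<alpha> \<in> I \<Longrightarrow> x \<in> U \<Longrightarrow>
        \<bar>partial_deriv i (partial_deriv j (\<Phi> \<alpha>)) x\<bar> \<le> C\<^sub>0"
    and det: "\<And>\<alpha> x. \<alpha> \<in> I \<Longrightarrow> x \<in> U \<Longrightarrow>
        (let D = \<bar>det (vector
              [vector [partial_deriv 1 (\<Phi> \<alpha>) x, parameter_deriv 1 \<Phi> \<alpha> x],
               vector [partial_deriv 2 (\<Phi> \<alpha>) x, parameter_deriv 2 \<Phi> \<alpha> x]] :: real ^ 2 ^ 2)\<bar>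
         in inverse C\<^sub>0 \<le> D \<and> D \<le> C\<^sub>0)"
    and V: "compact V" "V \<subseteq> U"
  shows "\<exists>\<delta>\<^sub>0>0. \<exists>C>0. \<forall>\<delta> Q E \<S>.
      \<delta> < \<delta>\<^sub>0 \<and> compact_square \<delta> Q \<and> Q \<subseteq> V \<and>
      finite \<S> \<and> (\<forall>S\<in>\<S>. compact_square (\<delta>\<^sup>2) S) \<and> E = \<Union>\<S> \<and> E \<subseteq> Q \<longrightarrow>
      gen_favard_length I \<Phi> E \<le> ennreal C * favard_length E"
proof (cases "I = {}")
  case True
  then show ?thesis by (auto simp: gen_favard_length_def intro!: exI[of _ 1])
next
  case False
  obtain a b where ab: "a < b" and I_eq: "I = {a<..<b}"
    using open_bounded_interval_eq[OF I False] by blast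
  obtain D H P where D: "\<And>\<alpha> x. \<alpha> \<in> I \<Longrightarrow> x \<in> U \<Longrightarrow> (\<Phi> \<alpha> has_derivative D \<alpha> x) (at x)"
    and H: "\<And>\<alpha> x w. \<alpha> \<in> I \<Longrightarrow> x \<in> U \<Longrightarrow> ((\<lambda>y. D \<alpha> y w) has_derivative (\<lambda>v. H \<alpha> x v w)) (at x)"
    and bil: "\<And>\<alpha> x. bilinear (H \<alpha> x)"
    and P: "\<And>\<alpha> x w. \<alpha> \<in> I \<Longrightarrow> x \<in> U \<Longrightarrow> ((\<lambda>\<beta>. D \<beta> x w) has_real_derivative P \<alpha> x w) (at \<alpha>)"
    and cP: "\<And>x w. x \<in> U \<Longrightarrow> continuous_on I (\<lambda>\<alpha>. P \<alpha> x w)"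
  proof (rule C2_on_slice_derivs[OF C2], goal_cases)
    case (1 D H P)
    from 1(2-) show ?case by (rule 1(1))
  qed
  have pd: "partial_deriv i (\<Phi> \<alpha>) x = D \<alpha> x (axis i 1)" if "\<alpha> \<in> I" "x \<in> U" for i \<alpha> x
    using D[OF that] by (rule partial_deriv_eq)
  have pd2: "partial_deriv i (partial_deriv j (\<Phi> \<alpha>)) x = H \<alpha> x (axis i 1) (axis j 1)"
    if "\<alpha> \<in> I" "x \<in> U" for i j \<alpha> x
    using partial_deriv_cong_open[OF U that(2) pd[OF that(1)]] partial_deriv_eq[OF H[OF that]]
    by simp
  have pa: "parameter_deriv i \<Phi> \<alpha> x = P \<alpha> x (axis i 1)" if "\<alpha> \<in> I" "x \<in> U" for i \<alpha> x
  proof -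
    \<comment> \<open>\<open>pd\<close> speaks only of parameters in \<open>I\<close>; openness of
      \<open>I\<close> makes this enough for a derivative at \<alpha>.\<close>
    have "((\<lambda>\<beta>. partial_deriv i (\<Phi> \<beta>) x) has_real_derivative P \<alpha> x (axis i 1)) (at \<alpha>)"
      using has_field_derivative_transform_within_open[OF P[OF that] I(1) that(1)] pd that(2)
      by simp
    then show ?thesis unfolding parameter_deriv_def by (rule DERIV_imp_deriv)
  qed
  \<comment> \<open>The factor \<open>4 * C\<^sub>0\<close> of the bilinear bound is halved by
    Taylor's formula.\<close>
  have remainder: "\<bar>\<Phi> \<alpha> y - \<Phi> \<alpha> p - D \<alpha> p (y - p)\<bar> \<le> 2 * C\<^sub>0 * (norm (y - p))\<^sup>2"
    if \<alpha>: "\<alpha> \<in> I" and seg: "closed_segment p y \<subseteq> U" for \<alpha> p y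
  proof -
    have "\<bar>H \<alpha> x (y - p) (y - p)\<bar> \<le> 4 * C\<^sub>0 * (norm (y - p))\<^sup>2"
      if "x \<in> closed_segment p y" for x
      using bilinear_bound_vec2[OF bil, of \<alpha> x C\<^sub>0] second[OF \<alpha>, of x] pd2[OF \<alpha>, of x] seg that
      by (fastforce simp: power2_eq_square mult.assoc)
    then show ?thesis
      using Taylor_quadratic_segment[of p y "\<Phi> \<alpha>" "D \<alpha>" "H \<alpha>" "4 * C\<^sub>0 * (norm (y - p))\<^sup>2"]
        D[OF \<alpha>] H[OF \<alpha>] seg by (simp add: subset_iff)
  qed
  \<comment> \<open>The speed of the angle is a determinant between \<open>inverse C\<^sub>0\<close>
    and \<open>C\<^sub>0\<close> divided by a squared gradient norm between
    \<open>(inverse C\<^sub>0)\<^sup>2\<close> and \<open>C\<^sub>0\<^sup>2\<close>, hence the cube.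
    \<open>N\<close> allows for one extra period, and \<open>20 * C\<^sub>0\<close> is the loss on
    each slice. All three constants are fixed before \<open>Q\<close>, whereas the angle function
    below depends on the corner of \<open>Q\<close>.\<close>
  define M where "M = C\<^sub>0 ^ 3"
  define N where "N = nat \<lceil>2 * M * (b - a) / pi\<rceil> + 1"
  define C where "C = 20 * C\<^sub>0 * (M * N)"
  have M: "0 < M" using C0 by (simp add: M_def)
  have N: "2 * M * (b - a) \<le> (real N - 1) * pi"
    using real_nat_ceiling_ge[of "2 * M * (b - a) / pi"] by (simp add: N_def pos_divide_le_eq)
  have "gen_favard_length I \<Phi> E \<le> ennreal C * favard_length E"
    if Q: "compact_square \<delta> Q" "Q \<subseteq> V" and fin: "finite \<S>"
      and sq: "\<And>S. S \<in> \<S> \<Longrightarrow> compact_square (\<delta>\<^sup>2) S" and E: "E = \<Union>\<S>" "E \<subseteq> Q"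
    for \<delta> Q E \<S>
  proof -
    obtain p where p: "p \<in> Q" "\<And>x. x \<in> Q \<Longrightarrow> dist x p \<le> 2 * \<delta> \<and> closed_segment p x \<subseteq> Q"
      using compact_square_corner[OF Q(1)] by blast
    have pU: "p \<in> U" using p(1) Q(2) V(2) by blast
    have cE: "compact E" unfolding E(1) using fin sq compact_compact_square by (intro compact_Union) auto
    define g h where "g t = D t p (axis 1 1)" and "h t = D t p (axis 2 1)" for t
    define g' h' where "g' t = P t p (axis 1 1)" and "h' t = P t p (axis 2 1)" for t
    have nrm: "inverse C\<^sub>0 \<le> sqrt ((g t)\<^sup>2 + (h t)\<^sup>2)" "sqrt ((g t)\<^sup>2 + (h t)\<^sup>2) \<le> C\<^sub>0"
      if "t \<in> I" for t
      using grad[OF that pU] pd[OF that pU]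
      by (auto simp: gradient_def norm_vec_def L2_set_def sum_2 g_def h_def)
    have pos: "0 < (g t)\<^sup>2 + (h t)\<^sup>2" if "t \<in> I" for t
    proof -
      have "0 < inverse C\<^sub>0" using C0 by simp
      also have "\<dots> \<le> sqrt ((g t)\<^sup>2 + (h t)\<^sup>2)" using nrm that by blast
      finally show ?thesis by simp
    qed
    have dt: "inverse C\<^sub>0 \<le> \<bar>g t * h' t - h t * g' t\<bar>" "\<bar>g t * h' t - h t * g' t\<bar> \<le> C\<^sub>0"
      if "t \<in> I" for t
      using det[OF that pU] pd[OF that pU] pa[OF that pU]
      by (auto simp: Let_def det_2 g_def h_def g'_def h'_def mult.commute)
    obtain \<theta> where \<theta>: "\<And>t. t \<in> I \<Longrightarrow>
        (\<theta> has_real_derivative (g t * h' t - h t * g' t) / ((g t)\<^sup>2 + (h t)\<^sup>2)) (at t)"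
      and polar: "\<And>t. t \<in> I \<Longrightarrow> g t = sqrt ((g t)\<^sup>2 + (h t)\<^sup>2) * cos (\<theta> t)"
        "\<And>t. t \<in> I \<Longrightarrow> h t = sqrt ((g t)\<^sup>2 + (h t)\<^sup>2) * sin (\<theta> t)"
    proof (rule polar_angle_lift[OF ab, of g g' h h', folded I_eq])
      show "continuous_on I g'" "continuous_on I h'"
        unfolding g'_def[abs_def] h'_def[abs_def] by (rule cP[OF pU])+
    qed (use P[OF _ pU] pos in \<open>auto simp: g_def[abs_def] h_def[abs_def] g'_def h'_def\<close>)
    let ?\<theta>' = "\<lambda>t. (g t * h' t - h t * g' t) / ((g t)\<^sup>2 + (h t)\<^sup>2)"
    have speed: "inverse M \<le> \<bar>?\<theta>' t\<bar>" "\<bar>?\<theta>' t\<bar> \<le> M" if "t \<in> I" for t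
    proof -
      define n where "n = (g t)\<^sup>2 + (h t)\<^sup>2"
      have n: "0 < n" "inverse C\<^sub>0 \<le> sqrt n" "sqrt n \<le> C\<^sub>0"
        using pos nrm that by (auto simp: n_def)
      have n': "(inverse C\<^sub>0)\<^sup>2 \<le> n" "n \<le> C\<^sub>0\<^sup>2"
        using power_mono[OF n(2), of 2] power_mono[OF n(3), of 2] n(1) C0 by auto
      have "inverse M = inverse C\<^sub>0 / C\<^sub>0\<^sup>2"
        by (simp add: M_def power_numeral_reduce divide_inverse)
      also have "\<dots> \<le> \<bar>g t * h' t - h t * g' t\<bar> / n"
        using dt[OF that] n n' C0 by (intro frac_le) auto
      finally show "inverse M \<le> \<bar>?\<theta>' t\<bar>" using n by (simp add: n_def)
      have "\<bar>g t * h' t - h t * g' t\<bar> / n \<le> C\<^sub>0 / (inverse C\<^sub>0)\<^sup>2"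
        using dt[OF that] n n' C0 by (intro frac_le) auto
      also have "\<dots> = M" by (simp add: M_def power_numeral_reduce divide_inverse)
      finally show "\<bar>?\<theta>' t\<bar> \<le> M" using n by (simp add: n_def)
    qed
    have slice: "emeasure lebesgue (\<Phi> t ` E)
        \<le> ennreal (20 * C\<^sub>0) * emeasure lebesgue (angle_proj (\<theta> t) ` E)" if t: "t \<in> I" for t
    proof -
      define \<rho> where "\<rho> = sqrt ((g t)\<^sup>2 + (h t)\<^sup>2)"
      have Dp: "D t p v = \<rho> * angle_proj (\<theta> t) v" for v
      proof -
        interpret linear "D t p" by (rule has_derivative_linear[OF D[OF t pU]])
        have "v = v $ 1 *\<^sub>R axis 1 1 + v $ 2 *\<^sub>R axis 2 1"
          by (simp add: vec_eq_iff forall_2 axis_def)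
        then have "D t p v = v $ 1 * g t + v $ 2 * h t"
          unfolding g_def h_def by (metis add scale real_scaleR_def)
        also have "\<dots> = \<rho> * angle_proj (\<theta> t) v"
          by (subst polar(1)[OF t], subst polar(2)[OF t])
             (simp add: \<rho>_def angle_proj_def algebra_simps)
        finally show ?thesis .
      qed
      \<comment> \<open>Here the side of the small squares matches the Taylor error:
        \<open>2 * C\<^sub>0 * (2 * \<delta>)\<^sup>2\<close> is \<open>8 * C\<^sub>0\<close> times
        the side \<open>\<delta>\<^sup>2\<close>, and the slope \<rho> is at most
        \<open>C\<^sub>0\<close>.\<close>
      have "emeasure lebesgue (\<Phi> t ` \<Union>\<S>)
          \<le> ennreal (2 * (8 * C\<^sub>0 + 2 * C\<^sub>0)) * emeasure lebesgue (angle_proj (\<theta> t) ` \<Union>\<S>)"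
      proof (rule emeasure_image_squares_le[OF fin sq])
        show "\<bar>\<rho>\<bar> \<le> C\<^sub>0" using nrm[OF t] pos[OF t] by (simp add: \<rho>_def)
        fix x assume "x \<in> \<Union>\<S>"
        then have x: "x \<in> Q" using E by blast
        have "closed_segment p x \<subseteq> U" using p(2)[OF x] Q(2) V(2) by blast
        then have "\<bar>\<Phi> t x - \<Phi> t p - D t p (x - p)\<bar> \<le> 2 * C\<^sub>0 * (norm (x - p))\<^sup>2"
          by (rule remainder[OF t])
        also have "\<dots> \<le> 2 * C\<^sub>0 * (2 * \<delta>)\<^sup>2"
          using p(2)[OF x] C0 by (intro mult_left_mono power_mono) (auto simp: dist_norm)
        finally show "\<bar>\<Phi> t x - ((\<Phi> t p - \<rho> * angle_proj (\<theta> t) p) + \<rho> * angle_proj (\<theta> t) x)\<bar>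
            \<le> 8 * C\<^sub>0 * \<delta>\<^sup>2"
          by (simp add: Dp angle_proj_diff algebra_simps power2_eq_square)
      qed
      then show ?thesis by (simp add: E(1))
    qed
    \<comment> \<open>Measurability is needed to pull the constant out of the integral. As \<theta>
      is controlled only on \<open>I\<close>, it is cut off by the indicator to become a Borel
      function on the line; the integrand does not change.\<close>
    have "continuous_on I \<theta>"
      using \<theta> by (intro continuous_at_imp_continuous_on) (blast intro: DERIV_isCont)
    then have meas: "(\<lambda>t. indicator I t *\<^sub>R \<theta> t) \<in> borel_measurable borel"
      using I(1) by (intro borel_measurable_continuous_on_indicator) auto
    have "(\<lambda>t. emeasure lborel (angle_proj (indicator I t *\<^sub>R \<theta> t) ` E) * indicator I t)
        \<in> borel_measurable lborel"
      using measurable_compose[OF meas borel_measurable_emeasure_angle_proj[OF cE]] I(1)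
      by (intro borel_measurable_times_ennreal borel_measurable_indicator) auto
    also have "(\<lambda>t. emeasure lborel (angle_proj (indicator I t *\<^sub>R \<theta> t) ` E) * indicator I t)
        = (\<lambda>t. emeasure lebesgue (angle_proj (\<theta> t) ` E) * indicator I t)"
      by (auto simp: fun_eq_iff emeasure_angle_proj_lborel[OF cE] indicator_def)
    finally have meas': "(\<lambda>t. emeasure lebesgue (angle_proj (\<theta> t) ` E) * indicator I t)
        \<in> borel_measurable lborel" .
    have "gen_favard_length I \<Phi> E
        \<le> (\<integral>\<^sup>+t. ennreal (20 * C\<^sub>0) * (emeasure lebesgue (angle_proj (\<theta> t) ` E) * indicator I t)
            \<partial>lborel)"
      unfolding gen_favard_length_def nn_integral_completion using slice
      by (intro nn_integral_mono) (auto simp: indicator_def)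
    also have "\<dots> = ennreal (20 * C\<^sub>0)
        * (\<integral>\<^sup>+t\<in>I. emeasure lebesgue (angle_proj (\<theta> t) ` E) \<partial>lebesgue)"
      unfolding nn_integral_completion by (rule nn_integral_cmult[OF meas'])
    also have "\<dots> \<le> ennreal (20 * C\<^sub>0) * (ennreal (M * N) * favard_length E)"
      unfolding I_eq using \<theta> speed
      by (intro mult_left_mono nn_integral_angle_proj_curve_le[OF cE _ _ _ M N, where \<theta>' = ?\<theta>'])
         (auto simp: I_eq)
    also have "\<dots> = ennreal C * favard_length E"
      using C0 M by (simp add: C_def ennreal_mult mult.assoc)
    finally show ?thesis .
  qed
  moreover have "0 < C" using C0 M by (simp add: C_def N_def)
  \<comment> \<open>The estimate is uniform in the side length of \<open>Q\<close>, so
    \<open>1\<close> can serve as \<open>\<delta>\<^sub>0\<close>.\<close>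
  ultimately show ?thesis by (intro exI[of _ 1] conjI exI[of _ C] allI impI) auto
qed

end
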